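(* For the CorrKO instance $\mathcal I_H$ described in the context (for any integer $H\ge4$), every non-adaptive policy obtains expected reward at most $\frac{2}{\sqrt H}$.
   Context: CorrKO: a finite metric $(V,d)$, root $\rho$, travel budget $B$, processing budget $W$; each vertex $v$ has random size $S_v$ and correlated random reward $R_v$, independent across vertices; a policy starts at $\rho$ and visits distinct vertices, processing each job non-preemptively with $(S_v,R_v)$ revealed on completion; if it visits $\rho=v_0,\dots,v_\ell$ then $\sum_{i=1}^\ell d(v_{i-1},v_i)\le B$ and $\sum_{i=1}^{\ell-1}S_{v_i}\le W$, and the reward of $v_i$ is collected iff $\sum_{h\le i}S_{v_h}\le W$. A non-adaptive policy fixes the sequence of vertices to visit in advance; it stops when a budget would be exceeded. The instance $\mathcal I_H$: let $T$ be a complete binary tree with $H$ levels, root $r$ at level $H$, leaves at level $1$; $\mathrm{lev}(v)$ is the level of $v$; the edge between a non-leaf $v$ at level $\ell$ and each of its children has length $2^{\ell-2}$; the metric is the induced tree metric on the nodes of $T$ plus a dummy root $\rho$ at distance $0$ from $r$ (with size and reward $0$). $W=2^{2^{H+1}}$, $B=2^{H-1}-1$. For $v\in T$, $\mathrm{path}(v)$ is the $r$-$v$ path in $T$, and $\mathrm{rt}(\mathrm{path}(v))$ is the set of nodes $w\ne v$ on $\mathrm{path}(v)$ whose successor on $\mathrm{path}(v)$ is the right child of $w$. Define $S^{(2)}_v=2^{2^{\mathrm{lev}(v)}}\prod_{w\in\mathrm{rt}(\mathrm{path}(v))}2^{2^{\mathrm{lev}(w)}}$, $S^{(1)}_v=W-\sum_{w\in\mathrm{rt}(\mathrm{path}(v))}S^{(2)}_w$,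 and $R^{(1)}_v=(1-1/\sqrt H)^{|\mathrm{rt}(\mathrm{path}(v))|}$. Then $(S_v,R_v)$ equals $(0,0)$ with probability $1-\frac1{\sqrt H}-\frac1H$, $(S^{(2)}_v,0)$ with probability $\frac1{\sqrt H}$, and $(S^{(1)}_v,R^{(1)}_v)$ with probability $\frac1H$. *)

theory Defs
  imports "HOL-Probability.Product_PMF" "HOL-Library.Sublist" Complex_Main
begin

section \<open>Correlated knapsack orienteering\<close>

text \<open>
  The job at a vertex is a joint distribution of a pair (size, reward); jobs at different vertices
  are independent.
\<close>

record 'v corrko =
  verts :: "'v set"
  distance :: "'v \<Rightarrow> 'v \<Rightarrow> real"
  start :: 'v
  travel_budget :: real
  proc_budget :: real
  job :: "'v \<Rightarrow> (real \<times> real) pmf"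

definition outcomes :: "'v corrko \<Rightarrow> ('v \<Rightarrow> real \<times> real) pmf" where
  "outcomes I = Pi_pmf (verts I) (0, 0) (job I)"

text \<open>
  Below, \<open>\<omega>\<close> is an outcome of all jobs, and a list \<open>[v\<^sub>1, \<dots>, v\<^sub>l]\<close> stands for the visit sequence
  \<open>\<rho> = v\<^sub>0, v\<^sub>1, \<dots>, v\<^sub>l\<close>; the root itself is not a job.
\<close>

definition travel_length :: "'v corrko \<Rightarrow> 'v list \<Rightarrow> real" where
  "travel_length I vs = (\<Sum>i<length vs. distance I ((start I # vs) ! i) ((start I # vs) ! Suc i))"

text \<open>
  The size of the last visited job is not counted: it is only revealed on completion, so the last
  job may overrun the processing budget (and then yields no reward).
\<close>

definition within_budgets :: "'v corrko \<Rightarrow> ('v \<Rightarrow> real \<times> real) \<Rightarrow> 'v list \<Rightarrow> bool" where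
  "within_budgets I \<omega> vs \<longleftrightarrow>
     travel_length I vs \<le> travel_budget I \<and>
     (\<Sum>i<length vs - 1. fst (\<omega> (vs ! i))) \<le> proc_budget I"

definition collected_reward :: "'v corrko \<Rightarrow> ('v \<Rightarrow> real \<times> real) \<Rightarrow> 'v list \<Rightarrow> real" where
  "collected_reward I \<omega> vs =
     (\<Sum>i<length vs. if (\<Sum>h\<le>i. fst (\<omega> (vs ! h))) \<le> proc_budget I then snd (\<omega> (vs ! i)) else 0)"

definition nonadaptive_policy :: "'v corrko \<Rightarrow> 'v list \<Rightarrow> bool" where
  "nonadaptive_policy I vs \<longleftrightarrow> set vs \<subseteq> verts I \<and> distinct (start I # vs)"

definition visited :: "'v corrko \<Rightarrow> ('v \<Rightarrow> real \<times> real) \<Rightarrow> 'v list \<Rightarrow> 'v list" where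
  "visited I \<omega> vs =
     take (GREATEST n. n \<le> length vs \<and> within_budgets I \<omega> (take n vs)) vs"

definition expected_reward :: "'v corrko \<Rightarrow> 'v list \<Rightarrow> real" where
  "expected_reward I vs =
     measure_pmf.expectation (outcomes I) (\<lambda>\<omega>. collected_reward I \<omega> (visited I \<omega> vs))"


section \<open>Shortest-path distances in an edge-weighted graph\<close>

inductive walk :: "('v \<Rightarrow> 'v \<Rightarrow> real \<Rightarrow> bool) \<Rightarrow> 'v \<Rightarrow> 'v \<Rightarrow> real \<Rightarrow> bool"
  for edge where
  walk_refl: "walk edge u u 0"
| walk_step: "edge u v c \<Longrightarrow> walk edge v w l \<Longrightarrow> walk edge u w (c + l)"

definition path_dist :: "('v \<Rightarrow> 'v \<Rightarrow> real \<Rightarrow> bool) \<Rightarrow> 'v \<Rightarrow> 'v \<Rightarrow> real" where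
  "path_dist edge u v = Inf {l. walk edge u v l}"


section \<open>The binary tree instance\<close>

text \<open>
  A tree node is the list of turns (\<open>False\<close> = left, \<open>True\<close> = right) leading to it from the tree
  root \<open>r = Node []\<close>; the children of \<open>v\<close> are \<open>v @ [False]\<close> and \<open>v @ [True]\<close>.
\<close>

datatype vertex = Dummy | Node "bool list"

definition tree_nodes :: "nat \<Rightarrow> bool list set" where
  "tree_nodes H = {v. length v < H}"

definition lev :: "nat \<Rightarrow> bool list \<Rightarrow> nat" where
  "lev H v = H - length v"

inductive tree_edge :: "nat \<Rightarrow> vertex \<Rightarrow> vertex \<Rightarrow> real \<Rightarrow> bool" for H where
  dummy_root: "tree_edge H Dummy (Node []) 0"
| parent_child: "v @ [b] \<in> tree_nodes H \<Longrightarrow>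
    tree_edge H (Node v) (Node (v @ [b])) (2 ^ (lev H v - 2))"
| edge_sym: "tree_edge H x y c \<Longrightarrow> tree_edge H y x c"

definition root_path :: "bool list \<Rightarrow> bool list set" where
  "root_path v = {w. prefix w v}"

definition rt :: "bool list \<Rightarrow> bool list set" where
  "rt v = {w \<in> root_path v. w \<noteq> v \<and> w @ [True] \<in> root_path v}"

definition tree_W :: "nat \<Rightarrow> real" where
  "tree_W H = 2 ^ (2 ^ (H + 1))"

definition tree_B :: "nat \<Rightarrow> real" where
  "tree_B H = 2 ^ (H - 1) - 1"

definition size2 :: "nat \<Rightarrow> bool list \<Rightarrow> real" where
  "size2 H v = 2 ^ (2 ^ lev H v) * (\<Prod>w\<in>rt v. 2 ^ (2 ^ lev H w))"

definition size1 :: "nat \<Rightarrow> bool list \<Rightarrow> real" where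
  "size1 H v = tree_W H - (\<Sum>w\<in>rt v. size2 H w)"

definition reward1 :: "nat \<Rightarrow> bool list \<Rightarrow> real" where
  "reward1 H v = (1 - 1 / sqrt (real H)) ^ card (rt v)"

definition node_table :: "nat \<Rightarrow> bool list \<Rightarrow> ((real \<times> real) \<times> real) list" where
  "node_table H v =
     [((0, 0), 1 - 1 / sqrt (real H) - 1 / real H),
      ((size2 H v, 0), 1 / sqrt (real H)),
      ((size1 H v, reward1 H v), 1 / real H)]"

fun tree_job :: "nat \<Rightarrow> vertex \<Rightarrow> (real \<times> real) pmf" where
  "tree_job H Dummy = return_pmf (0, 0)"
| "tree_job H (Node v) = pmf_of_list (node_table H v)"

text \<open>
  The dummy root is at distance 0 from \<open>Node []\<close>, so the distance is only a pseudometric.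
\<close>

definition tree_instance :: "nat \<Rightarrow> vertex corrko" where
  "tree_instance H =
     \<lparr> verts = insert Dummy (Node ` tree_nodes H),
       distance = path_dist (tree_edge H),
       start = Dummy,
       travel_budget = tree_B H,
       proc_budget = tree_W H,
       job = tree_job H \<rparr>"


section \<open>Well-formedness of the instance\<close>

text \<open>\<open>pmf_of_list\<close> is only meaningful for well-formed tables.\<close>

lemma node_table_wf:
  assumes "H \<ge> 4"
  shows "pmf_of_list_wf (node_table H v)"
proof -
  define s where "s = sqrt (real H)"
  have s2: "s \<ge> 2" unfolding s_def using assms by (intro real_le_rsqrt) auto
  have Hs: "real H = s * s" unfolding s_def by simp
  have "1 / s \<le> 1 / 2" using s2 by (simp add: field_simps)
  moreover have "1 / (s * s) \<le> 1 / 4"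
    using mult_mono[OF s2 s2] s2 by (simp add: field_simps)
  ultimately have "1 - 1 / s - 1 / (s * s) \<ge> 0" by simp
  then show ?thesis
    unfolding pmf_of_list_wf_def node_table_def s_def[symmetric] unfolding Hs using s2 by auto
qed

lemma finite_verts: "finite (verts (tree_instance H))"
proof -
  have "tree_nodes H \<subseteq> {v. set v \<subseteq> UNIV \<and> length v \<le> H}" by (auto simp: tree_nodes_def)
  then have "finite (tree_nodes H)"
    by (rule finite_subset) (rule finite_lists_length_le, simp)
  then show ?thesis by (simp add: tree_instance_def)
qed

lemma tree_edge_nonneg: "tree_edge H x y c \<Longrightarrow> c \<ge> 0"
  by (induction rule: tree_edge.induct) auto

lemma walk_nonneg: "walk (tree_edge H) x y l \<Longrightarrow> l \<ge> 0"
  by (induction rule: walk.induct) (auto dest: tree_edge_nonneg)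

lemma walk_trans: "walk e x y l \<Longrightarrow> walk e y z k \<Longrightarrow> walk e x z (l + k)"
  by (induction rule: walk.induct) (auto simp: add.assoc intro: walk_step)

lemma walk_edge: "e x y c \<Longrightarrow> walk e x y c"
  using walk_step[of e x y c y 0] walk_refl[of e y] by simp

lemma walk_sym: "walk (tree_edge H) x y l \<Longrightarrow> walk (tree_edge H) y x l"
proof (induction rule: walk.induct)
  case (walk_step u v c w l)
  have "walk (tree_edge H) v u c" by (rule walk_edge, rule edge_sym, rule walk_step(1))
  from walk_trans[OF walk_step(3) this] show ?case by (simp add: add.commute)
qed (rule walk_refl)

lemma walk_from_dummy:
  assumes "x \<in> verts (tree_instance H)"
  shows "\<exists>l. walk (tree_edge H) Dummy x l"
proof (cases x)
  case Dummy
  then show ?thesis using walk_refl by metis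
next
  case (Node v)
  have "length v < H \<Longrightarrow> \<exists>l. walk (tree_edge H) Dummy (Node v) l"
  proof (induction v rule: rev_induct)
    case Nil
    then show ?case using walk_edge[of "tree_edge H", OF dummy_root] by metis
  next
    case (snoc b v)
    then obtain l where "walk (tree_edge H) Dummy (Node v) l" by auto
    moreover have "walk (tree_edge H) (Node v) (Node (v @ [b])) (2 ^ (lev H v - 2))"
      using snoc.prems by (intro walk_edge parent_child) (simp add: tree_nodes_def)
    ultimately show ?case using walk_trans by metis
  qed
  then show ?thesis using assms Node by (auto simp: tree_instance_def tree_nodes_def)
qed

lemma walk_exists:
  assumes "x \<in> verts (tree_instance H)" "y \<in> verts (tree_instance H)"
  shows "\<exists>l. walk (tree_edge H) x y l"
proof -
  obtain k l where "walk (tree_edge H) Dummy x k" "walk (tree_edge H) Dummy y l"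
    using walk_from_dummy assms by meson
  then show ?thesis using walk_trans[OF walk_sym] by meson
qed

lemma path_dist_le: "walk (tree_edge H) x y l \<Longrightarrow> path_dist (tree_edge H) x y \<le> l"
  unfolding path_dist_def by (rule cInf_lower) (auto intro!: bdd_belowI[of _ 0] dest: walk_nonneg)

lemma distance_pseudometric:
  assumes "x \<in> verts (tree_instance H)" "y \<in> verts (tree_instance H)"
    "z \<in> verts (tree_instance H)"
  defines "d \<equiv> distance (tree_instance H)"
  shows "d x y \<ge> 0" "d x x = 0" "d x y = d y x" "d x z \<le> d x y + d y z"
proof -
  have d: "d = path_dist (tree_edge H)" by (simp add: d_def tree_instance_def)
  have nonneg: "d u v \<ge> 0" if "u \<in> verts (tree_instance H)" "v \<in> verts (tree_instance H)" for u v
    unfolding d path_dist_def using walk_exists[OF that]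
    by (intro cInf_greatest) (auto dest: walk_nonneg)
  show "d x y \<ge> 0" using nonneg assms by blast
  show "d x x = 0" using nonneg[of x x] path_dist_le[OF walk_refl, of H x] assms d by auto
  have "{l. walk (tree_edge H) x y l} = {l. walk (tree_edge H) y x l}" using walk_sym by blast
  then show "d x y = d y x" by (simp add: d path_dist_def)
  have 1: "d x z - l \<le> d y z" if "walk (tree_edge H) x y l" for l
  proof -
    have "d x z - l \<le> k" if "walk (tree_edge H) y z k" for k
      using path_dist_le[OF walk_trans[OF \<open>walk (tree_edge H) x y l\<close> that]] d by simp
    then show ?thesis unfolding d path_dist_def[of _ y z] using walk_exists[OF assms(2,3)]
      by (intro cInf_greatest) (auto simp: d)
  qed
  have "d x z - d y z \<le> d x y"
    unfolding d path_dist_def[of _ x y] using walk_exists[OF assms(1,2)] 1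
    by (intro cInf_greatest) (auto simp: d algebra_simps)
  then show "d x z \<le> d x y + d y z" by simp
qed

end

theory Submission imports Defs begin

text \<open>
  A direct descent from the root to a leaf uses up the travel budget, and stepping down from a node
  to a child and back is longer than a direct descent from that node to a leaf. Hence the vertices
  visited within the travel budget form a descending chain \<open>u\<^sub>0, u\<^sub>1, \<dots>\<close>. The reward of \<open>u\<^sub>i\<close> can
  only be collected if \<open>u\<^sub>i\<close> has size \<open>size1\<close>, which leaves the earlier jobs a total size of at most
  \<open>\<Sum>w\<in>rt u\<^sub>i. size2 w\<close>. By the doubly exponential growth of the sizes, an earlier \<open>u\<^sub>h\<close> whose left
  subtree contains \<open>u\<^sub>i\<close> must then not have size \<open>size2\<close>. With \<open>q = 1 - 1 / sqrt H\<close>, each such \<open>u\<^sub>h\<close>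
  contributes a factor \<open>q\<close> to the probability, and each other earlier \<open>u\<^sub>h\<close>, lying in \<open>rt u\<^sub>i\<close>, a
  factor \<open>q\<close> to the reward. So \<open>u\<^sub>i\<close> yields at most \<open>q ^ i / H\<close> in expectation, and these bounds sum
  to at most \<open>1 / sqrt H\<close>.
\<close>

section \<open>Distances\<close>

lemma walk_potential:
  fixes f :: "'v \<Rightarrow> real"
  assumes "\<And>x y c. edge x y c \<Longrightarrow> f y - f x \<le> c"
    and "walk edge x y l"
  shows "f y - f x \<le> l"
  using assms(2) by (induction rule: walk.induct) (use assms(1) in fastforce)+

text \<open>A distance is an infimum over walks, so a lower bound needs a certificate: a potential
  that rises along each edge by at most the length of that edge.\<close>

lemma distance_potential:
  fixes f :: "vertex \<Rightarrow> real"
  assumes "\<And>x y c. tree_edge H x y c \<Longrightarrow> f y - f x \<le> c"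
    and "x \<in> verts (tree_instance H)" "y \<in> verts (tree_instance H)"
  shows "f y - f x \<le> distance (tree_instance H) x y"
proof -
  have "f y - f x \<le> path_dist (tree_edge H) x y"
    unfolding path_dist_def using walk_exists[OF assms(2,3)]
    by (intro cInf_greatest) (auto intro: walk_potential[OF assms(1)])
  then show ?thesis by (simp add: tree_instance_def)
qed

text \<open>Length of the descent from the root: the edge lengths 2^(H-2), 2^(H-3), ... sum to this
  difference of powers. At a leaf it equals \<open>tree_B H\<close>.\<close>

fun depth :: "nat \<Rightarrow> vertex \<Rightarrow> real" where
  "depth H Dummy = 0"
| "depth H (Node v) = 2 ^ (H - 1) - 2 ^ (H - 1 - length v)"

lemma lev_minus_2: "length v + 1 < H \<Longrightarrow> 2 * 2 ^ (lev H v - 2) = (2::real) ^ (H - 1 - length v)"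
  by (simp add: lev_def flip: power_Suc)

lemma tree_edge_depth: "tree_edge H x y c \<Longrightarrow> \<bar>depth H y - depth H x\<bar> \<le> c"
proof (induction rule: tree_edge.induct)
  case (parent_child v b)
  then have l: "length v + 1 < H" by (simp add: tree_nodes_def)
  then have "H - 1 - length (v @ [b]) = lev H v - 2" by (simp add: lev_def)
  then show ?case using lev_minus_2[OF l] by simp
qed auto

text \<open>The edge between \<open>a\<close> and this child is the only one joining the subtree of
  \<open>a @ [b]\<close> to the rest of the graph.\<close>

lemma tree_edge_enter_subtree:
  assumes "tree_edge H x y c"
    and "a @ [b] \<in> tree_nodes H"
  defines "below \<equiv> \<lambda>x. case x of Dummy \<Rightarrow> False | Node v \<Rightarrow> prefix (a @ [b]) v"
  shows "below x \<noteq> below y \<Longrightarrow> c = 2 ^ (lev H a - 2)"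
  using assms(1)
proof (induction rule: tree_edge.induct)
  case (parent_child v b')
  then show ?case by (auto simp: below_def)
qed (auto simp: below_def)

lemma distance_leave_subtree:
  assumes "a @ [b] \<in> tree_nodes H" "prefix (a @ [b]) u" "\<not> prefix (a @ [b]) v"
    and "u \<in> tree_nodes H" "v \<in> tree_nodes H"
  shows "2 ^ (lev H a - 2) \<le> distance (tree_instance H) (Node u) (Node v)"
proof -
  \<comment> \<open>Constant on either side of the edge above the subtree, with a jump equal to the
    length of that edge.\<close>
  define f :: "vertex \<Rightarrow> real" where
    "f x = (if (case x of Dummy \<Rightarrow> False | Node v \<Rightarrow> prefix (a @ [b]) v) then 0 else 2 ^ (lev H a - 2))" for x
  have "f y - f x \<le> c" if "tree_edge H x y c" for x y c
    using tree_edge_enter_subtree[OF that assms(1)] tree_edge_nonneg[OF that]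
    unfolding f_def by (auto split: if_splits)
  then have "f (Node v) - f (Node u) \<le> distance (tree_instance H) (Node u) (Node v)"
    using assms by (intro distance_potential) (auto simp: tree_instance_def)
  then show ?thesis using assms by (simp add: f_def)
qed

section \<open>Travel lengths of visit sequences\<close>

lemma distance_nonneg:
  "x \<in> verts (tree_instance H) \<Longrightarrow> y \<in> verts (tree_instance H) \<Longrightarrow> distance (tree_instance H) x y \<ge> 0"
  using distance_pseudometric(1)[of x H y x] by simp

lemma visit_in_verts:
  assumes "set vs \<subseteq> verts (tree_instance H)" "i \<le> length vs"
  shows "(Dummy # vs) ! i \<in> verts (tree_instance H)"
proof -
  have "(Dummy # vs) ! i \<in> set (Dummy # vs)" using assms(2) by (intro nth_mem) simp
  moreover have "Dummy \<in> verts (tree_instance H)" by (simp add: tree_instance_def)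
  ultimately show ?thesis using assms(1) by auto
qed

lemma start_tree_instance: "start (tree_instance H) = Dummy"
  by (simp add: tree_instance_def)

lemma travel_length_take:
  "m \<le> length vs \<Longrightarrow> travel_length I (take m vs)
    = (\<Sum>i<m. distance I ((start I # vs) ! i) ((start I # vs) ! Suc i))"
  unfolding travel_length_def by (intro sum.cong) (auto simp: nth_Cons')

lemma travel_length_take_mono:
  assumes "set vs \<subseteq> verts (tree_instance H)" "m \<le> length vs"
  shows "travel_length (tree_instance H) (take m vs) \<le> travel_length (tree_instance H) vs"
proof -
  let ?I = "tree_instance H" and ?p = "Dummy # vs"
  have "(\<Sum>i<m. distance ?I (?p ! i) (?p ! Suc i))
      \<le> (\<Sum>i<length vs. distance ?I (?p ! i) (?p ! Suc i))"
    using assms by (intro sum_mono2) (auto intro!: distance_nonneg visit_in_verts simp del: nth_Cons_Suc)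
  then show ?thesis
    using assms(2)
    by (subst travel_length_take) (simp_all add: travel_length_def start_tree_instance)
qed

text \<open>\<open>depth\<close> is a potential that vanishes at \<open>Dummy\<close>, so its
  increments along the visits telescope.\<close>

lemma depth_le_travel_length:
  assumes "set vs \<subseteq> verts (tree_instance H)"
  shows "depth H (last (Dummy # vs)) \<le> travel_length (tree_instance H) vs"
proof -
  let ?I = "tree_instance H"
  have "depth H (last (Dummy # vs)) = depth H ((Dummy # vs) ! length vs) - depth H ((Dummy # vs) ! 0)"
    by (subst last_conv_nth) auto
  also have "\<dots> = (\<Sum>i<length vs. depth H ((Dummy # vs) ! Suc i) - depth H ((Dummy # vs) ! i))"
    by (rule sum_lessThan_telescope[symmetric])
  also have "\<dots> \<le> (\<Sum>i<length vs. distance ?I ((Dummy # vs) ! i) ((Dummy # vs) ! Suc i))"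
    using assms
    by (intro sum_mono distance_potential visit_in_verts) (auto dest: tree_edge_depth)
  also have "\<dots> = travel_length ?I vs"
    by (simp add: travel_length_def start_tree_instance)
  finally show ?thesis .
qed

text \<open>Reaching \<open>u\<close> costs at least its depth, which is 2^(H-1) minus the length of
  the edge above \<open>u\<close>. Moving on to a vertex outside the subtree of \<open>u\<close>
  costs at least that length again. The total 2^(H-1) exceeds the budget by 1.\<close>

lemma strict_prefix_within_travel_budget:
  assumes "travel_length (tree_instance H) (map Node xs) \<le> tree_B H"
    and "set xs \<subseteq> tree_nodes H" "distinct xs"
  shows "sorted_wrt strict_prefix xs"
proof -
  let ?I = "tree_instance H"
  have "strict_prefix (xs ! i) (xs ! Suc i)" if i: "Suc i < length xs" for i
  proof (rule ccontr)
    define u v where "u = xs ! i" and "v = xs ! Suc i"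
    assume "\<not> strict_prefix (xs ! i) (xs ! Suc i)"
    moreover have "u \<noteq> v" using assms(3) i by (simp add: u_def v_def nth_eq_iff_index_eq)
    ultimately have np: "\<not> prefix u v" by (auto simp: u_def v_def strict_prefix_def)
    \<comment> \<open>The root is a prefix of every node, so \<open>u\<close> has a parent edge,
      which has to be crossed.\<close>
    then have "u \<noteq> []" by auto
    then obtain a b where u: "u = a @ [b]" by (metis rev_exhaust)
    have uv: "u \<in> tree_nodes H" "v \<in> tree_nodes H" using assms(2) i by (auto simp: u_def v_def)
    then have l: "length a + 1 < H" by (simp add: u tree_nodes_def)
    let ?c = "2 ^ (lev H a - 2) :: real"
    have sub: "set (map Node xs) \<subseteq> verts ?I" using assms(2) by (auto simp: tree_instance_def)
    have "H - 1 - length u = lev H a - 2" by (simp add: u lev_def)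
    then have "2 ^ (H - 1) = depth H (Node u) + ?c" by simp
    also have "depth H (Node u) = depth H (last (Dummy # take (Suc i) (map Node xs)))"
      using i by (simp add: u_def take_Suc_conv_app_nth)
    also have "\<dots> \<le> travel_length ?I (take (Suc i) (map Node xs))"
      using sub by (intro depth_le_travel_length) (meson set_take_subset subset_trans)
    also have "?c \<le> distance ?I (Node u) (Node v)"
      using uv np u by (intro distance_leave_subtree) auto
    also have "travel_length ?I (take (Suc i) (map Node xs)) + distance ?I (Node u) (Node v)
        = travel_length ?I (take (Suc (Suc i)) (map Node xs))"
      using i by (simp add: travel_length_take u_def v_def)
    also have "\<dots> \<le> travel_length ?I (map Node xs)"
      using sub i by (intro travel_length_take_mono) auto
    finally show False using assms(1) by (simp add: tree_B_def)
  qed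
  \<comment> \<open>Transitivity of \<open>strict_prefix\<close> passes from consecutive visits to
    all pairs.\<close>
  then show ?thesis
    by (simp add: sorted_wrt_iff_nth_Suc_transp transp_def del: strict_prefix_simps)
qed

section \<open>Sizes\<close>

lemma rt_Nil: "rt [] = {}"
  by (auto simp: rt_def root_path_def)

lemma rt_snoc: "rt (u @ [b]) = (if b then insert u (rt u) else rt u)"
  by (auto simp: rt_def root_path_def)

lemma rt_strict_prefix: "w \<in> rt u \<Longrightarrow> strict_prefix w u"
  by (auto simp: rt_def root_path_def strict_prefix_def)

lemma finite_rt: "finite (rt u)"
  by (induction u rule: rev_induct) (auto simp: rt_Nil rt_snoc)

text \<open>Exponent of the product in \<open>size2\<close>, so that sizes can be compared through
  natural numbers.\<close>

definition rt_exponent :: "nat \<Rightarrow> bool list \<Rightarrow> nat" where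
  "rt_exponent H u = (\<Sum>w\<in>rt u. 2 ^ lev H w)"

lemma size2_eq: "size2 H v = 2 ^ (2 ^ lev H v + rt_exponent H v)"
  by (simp add: size2_def rt_exponent_def power_add power_sum)

lemma size2_pos: "size2 H v > 0"
  by (simp add: size2_eq)

lemma rt_exponent_snoc:
  "rt_exponent H (u @ [b]) = rt_exponent H u + (if b then 2 ^ lev H u else 0)"
  using rt_strict_prefix[of u u] by (auto simp: rt_exponent_def rt_snoc finite_rt sum.insert_if)

text \<open>The deepest term dominates: for a right turn at \<open>u\<close>,
  \<open>size2 H u\<close> is 2 to the power \<open>rt_exponent H (u @ [True])\<close>, and by
  induction the remaining terms together stay below that power.\<close>

lemma sum_size2_rt_less: "(\<Sum>w\<in>rt u. size2 H w) < 2 ^ (rt_exponent H u + 1)"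
proof (induction u rule: rev_induct)
  case (snoc b u)
  have u: "u \<notin> rt u" using rt_strict_prefix[of u u] by auto
  show ?case
  proof (cases b)
    case True
    have "(2::real) ^ (rt_exponent H u + 1) \<le> 2 ^ (2 ^ lev H u + rt_exponent H u)"
      by (intro power_increasing) auto
    then show ?thesis
      using snoc True u by (simp add: rt_snoc rt_exponent_snoc finite_rt size2_eq add.commute)
  qed (use snoc in \<open>simp add: rt_snoc rt_exponent_snoc\<close>)
qed (simp add: rt_Nil rt_exponent_def)

text \<open>The quantity never increases on the way down: a step from level l lowers the second term
  by 2^l, and a right turn gives back exactly 2^l.\<close>

lemma rt_exponent_append:
  assumes "length (u @ w) < H"
  shows "rt_exponent H (u @ w) + 2 ^ (lev H (u @ w) + 1) \<le> rt_exponent H u + 2 ^ (lev H u + 1)"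
  using assms
proof (induction w rule: rev_induct)
  case (snoc b w)
  have "lev H (u @ w @ [b]) + 1 = lev H (u @ w)" using snoc.prems by (simp add: lev_def)
  then show ?case
    using snoc rt_exponent_snoc[of H "u @ w" b] by simp
qed simp

text \<open>At the root the bound of \<open>rt_exponent_append\<close> is 2^(H+1), the exponent of
  \<open>tree_W H\<close>. This makes \<open>size1\<close> nonnegative.\<close>

lemma sum_size2_rt_le_W:
  assumes "length u < H"
  shows "(\<Sum>w\<in>rt u. size2 H w) \<le> tree_W H"
proof -
  have "rt_exponent H u + 2 ^ (lev H u + 1) \<le> 2 ^ (H + 1)"
    using rt_exponent_append[of "[]" u H] assms by (simp add: rt_exponent_def rt_Nil lev_def)
  moreover have "(1::nat) \<le> 2 ^ (lev H u + 1)" by simp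
  ultimately have "(2::real) ^ (rt_exponent H u + 1) \<le> 2 ^ 2 ^ (H + 1)"
    by (intro power_increasing) linarith+
  then show ?thesis using sum_size2_rt_less[of H u] by (simp add: tree_W_def)
qed

text \<open>A left turn at \<open>v\<close> lowers the level without adding to
  \<open>rt_exponent\<close>, so the bound of \<open>rt_exponent_append\<close> below it is the
  exponent of \<open>size2 H v\<close>.\<close>

lemma sum_size2_rt_less_left_ancestor:
  assumes "prefix (v @ [False]) u" "length u < H"
  shows "(\<Sum>w\<in>rt u. size2 H w) < size2 H v"
proof -
  obtain w where u: "u = (v @ [False]) @ w" using assms(1) by (auto elim: prefixE)
  have "lev H (v @ [False]) + 1 = lev H v" using assms(2) u by (simp add: lev_def)
  then have "rt_exponent H u + 2 ^ (lev H u + 1) \<le> 2 ^ lev H v + rt_exponent H v"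
    using rt_exponent_append[of "v @ [False]" w H] assms(2) u by (simp add: rt_exponent_snoc)
  \<comment> \<open>Room for the \<open>+ 1\<close> in \<open>sum_size2_rt_less\<close>.\<close>
  moreover have "(1::nat) \<le> 2 ^ (lev H u + 1)" by simp
  ultimately have "(2::real) ^ (rt_exponent H u + 1) \<le> size2 H v"
    unfolding size2_eq by (intro power_increasing) linarith+
  then show ?thesis using sum_size2_rt_less[of H u] by simp
qed

section \<open>Expected reward of a descending chain\<close>

lemma one_minus_inverse_sqrt_bounds:
  assumes "H \<ge> 4"
  shows "0 \<le> 1 - 1 / sqrt (real H)" "1 - 1 / sqrt (real H) \<le> 1"
proof -
  have "sqrt (real H) \<ge> 1" using assms by simp
  then show "0 \<le> 1 - 1 / sqrt (real H)" "1 - 1 / sqrt (real H) \<le> 1" by simp_all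
qed

section \<open>Single jobs and their joint outcomes\<close>

lemma set_tree_job:
  assumes "H \<ge> 4"
  shows "set_pmf (tree_job H (Node v)) \<subseteq> {(0, 0), (size2 H v, 0), (size1 H v, reward1 H v)}"
  using set_pmf_of_list[OF node_table_wf[OF assms], of v] by (auto simp: node_table_def)

lemma finite_set_tree_job: "H \<ge> 4 \<Longrightarrow> finite (set_pmf (tree_job H x))"
  by (cases x) (auto intro: finite_set_pmf_of_list node_table_wf)

lemma reward1_nonneg: "H \<ge> 4 \<Longrightarrow> 0 \<le> reward1 H v"
  using one_minus_inverse_sqrt_bounds by (simp add: reward1_def)

lemma prob_reward_nonzero:
  assumes "H \<ge> 4"
  shows "measure_pmf.prob (tree_job H (Node v)) {z. snd z \<noteq> 0} \<le> 1 / real H"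
  using measure_pmf_of_list[OF node_table_wf[OF assms], of v] by (simp add: node_table_def)

lemma prob_not_size2:
  assumes "H \<ge> 4"
  shows "measure_pmf.prob (tree_job H (Node v)) {z. fst z \<noteq> size2 H v} \<le> 1 - 1 / sqrt (real H)"
  using measure_pmf_of_list[OF node_table_wf[OF assms], of v] size2_pos[of H v]
  by (simp add: node_table_def)

lemma finite_set_outcomes: "H \<ge> 4 \<Longrightarrow> finite (set_pmf (outcomes (tree_instance H)))"
  unfolding outcomes_def set_Pi_pmf[OF finite_verts]
  by (intro finite_PiE_dflt finite_verts)
    (simp add: tree_instance_def finite_set_tree_job del: tree_job.simps)

lemma outcomes_cases:
  assumes "H \<ge> 4" "\<omega> \<in> set_pmf (outcomes (tree_instance H))" "v \<in> tree_nodes H"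
  shows "\<omega> (Node v) \<in> {(0, 0), (size2 H v, 0), (size1 H v, reward1 H v)}"
proof -
  have "\<omega> (Node v) \<in> set_pmf (tree_job H (Node v))"
    using assms(2,3) unfolding outcomes_def set_Pi_pmf[OF finite_verts]
    by (auto simp: PiE_dflt_def tree_instance_def)
  then show ?thesis using set_tree_job[OF assms(1)] by blast
qed

lemma outcomes_nonneg:
  assumes "H \<ge> 4" "\<omega> \<in> set_pmf (outcomes (tree_instance H))" "v \<in> tree_nodes H"
  shows "0 \<le> fst (\<omega> (Node v))" "0 \<le> snd (\<omega> (Node v))"
  using outcomes_cases[OF assms] size2_pos[of H v] sum_size2_rt_le_W[of v H] assms(3)
    reward1_nonneg[OF assms(1), of v]
  by (auto simp: size1_def tree_nodes_def)

text \<open>A nonzero reward forces size \<open>size1\<close> at \<open>xs ! i\<close>. The room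
  this leaves in the budget is the sum of \<open>size2\<close> over \<open>rt (xs ! i)\<close>,
  which \<open>size2 H v\<close> alone exceeds.\<close>

lemma collected_imp_not_size2:
  assumes "H \<ge> 4" "\<omega> \<in> set_pmf (outcomes (tree_instance H))"
    and "set xs \<subseteq> tree_nodes H" "i < length xs"
    and "(\<Sum>h\<le>i. fst (\<omega> (Node (xs ! h)))) \<le> tree_W H" "snd (\<omega> (Node (xs ! i))) \<noteq> 0"
    and "v \<in> set (take i xs)" "prefix (v @ [False]) (xs ! i)"
  shows "fst (\<omega> (Node v)) \<noteq> size2 H v"
proof
  assume eq: "fst (\<omega> (Node v)) = size2 H v"
  obtain j where j: "j < i" "v = xs ! j"
    using assms(4,7) by (auto simp: in_set_conv_nth)
  have mem: "xs ! h \<in> tree_nodes H" if "h \<le> i" for h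
    using that assms(3,4) by auto
  have "fst (\<omega> (Node (xs ! i))) = size1 H (xs ! i)"
    using outcomes_cases[OF assms(1,2) mem[of i]] assms(6) by auto
  then have "(\<Sum>h\<in>{i, j}. fst (\<omega> (Node (xs ! h)))) = size1 H (xs ! i) + size2 H v"
    using j eq by simp
  \<comment> \<open>The jobs \<open>i\<close> and \<open>j\<close> suffice for the overrun, all
    sizes being nonnegative.\<close>
  moreover have "(\<Sum>h\<in>{i, j}. fst (\<omega> (Node (xs ! h)))) \<le> (\<Sum>h\<le>i. fst (\<omega> (Node (xs ! h))))"
    using j mem outcomes_nonneg(1)[OF assms(1,2)] by (intro sum_mono2) auto
  moreover have "(\<Sum>w\<in>rt (xs ! i). size2 H w) < size2 H v"
    using assms(8) mem[of i] by (intro sum_size2_rt_less_left_ancestor) (auto simp: tree_nodes_def)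
  ultimately show False using assms(5) by (simp add: size1_def)
qed

text \<open>The event restricts each coordinate separately, so by independence its probability is a
  product over the vertices.\<close>

lemma prob_reward_and_not_size2:
  assumes "H \<ge> 4" "u \<in> tree_nodes H" "L \<subseteq> tree_nodes H"
  shows "measure_pmf.prob (outcomes (tree_instance H))
      {\<omega>. snd (\<omega> (Node u)) \<noteq> 0 \<and> (\<forall>v\<in>L. v \<noteq> u \<longrightarrow> fst (\<omega> (Node v)) \<noteq> size2 H v)}
    \<le> 1 / real H * (1 - 1 / sqrt (real H)) ^ card (L - {u})"
proof -
  let ?I = "tree_instance H" and ?q = "1 - 1 / sqrt (real H)"
  define F :: "vertex \<Rightarrow> (real \<times> real) set" where
    "F x = {z. (x = Node u \<longrightarrow> snd z \<noteq> 0) \<and>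
    (\<forall>v\<in>L. v \<noteq> u \<longrightarrow> x = Node v \<longrightarrow> fst z \<noteq> size2 H v)}" for x
  have nodes: "Node v \<in> verts ?I" if "v \<in> tree_nodes H" for v
    using that by (simp add: tree_instance_def)
  have "{\<omega>. snd (\<omega> (Node u)) \<noteq> 0 \<and> (\<forall>v\<in>L. v \<noteq> u \<longrightarrow> fst (\<omega> (Node v)) \<noteq> size2 H v)}
      = Pi (verts ?I) F"
  proof (intro equalityI subsetI)
    fix \<omega> assume "\<omega> \<in> Pi (verts ?I) F"
    then have F: "\<omega> (Node v) \<in> F (Node v)" if "v \<in> tree_nodes H" for v
      using nodes[OF that] by (rule Pi_mem)
    have "snd (\<omega> (Node u)) \<noteq> 0" using F[OF assms(2)] by (simp add: F_def)
    moreover have "fst (\<omega> (Node v)) \<noteq> size2 H v" if "v \<in> L" "v \<noteq> u" for v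
      using F[of v] that assms(3) by (auto simp: F_def)
    ultimately show "\<omega> \<in> {\<omega>. snd (\<omega> (Node u)) \<noteq> 0 \<and>
        (\<forall>v\<in>L. v \<noteq> u \<longrightarrow> fst (\<omega> (Node v)) \<noteq> size2 H v)}" by blast
  qed (auto simp: F_def)
  then have "measure_pmf.prob (outcomes ?I)
      {\<omega>. snd (\<omega> (Node u)) \<noteq> 0 \<and> (\<forall>v\<in>L. v \<noteq> u \<longrightarrow> fst (\<omega> (Node v)) \<noteq> size2 H v)}
      = (\<Prod>x\<in>verts ?I. measure_pmf.prob (job ?I x) (F x))"
    by (simp add: outcomes_def measure_Pi_pmf_Pi[OF finite_verts])
  \<comment> \<open>The bound on each factor is split in two, one part nontrivial only at
    \<open>u\<close> and one only on \<open>L - {u}\<close>, so that the two products can be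
    evaluated separately.\<close>
  also have "\<dots> \<le> (\<Prod>x\<in>verts ?I. (if x = Node u then 1 / real H else 1) *
      (if x \<in> Node ` (L - {u}) then ?q else 1))"
  proof (intro prod_mono conjI)
    fix x assume "x \<in> verts ?I"
    consider "x = Node u" | v where "v \<in> L" "v \<noteq> u" "x = Node v"
      | "x \<noteq> Node u" "x \<notin> Node ` (L - {u})" by auto
    then show "measure_pmf.prob (job ?I x) (F x) \<le> (if x = Node u then 1 / real H else 1) *
      (if x \<in> Node ` (L - {u}) then ?q else 1)"
    proof cases
      case 1
      then have "F x = {z. snd z \<noteq> 0}" by (auto simp: F_def)
      then show ?thesis using 1 prob_reward_nonzero[OF assms(1), of u] by (auto simp: tree_instance_def)
    next
      case 2
      then have "F x = {z. fst z \<noteq> size2 H v}" by (auto simp: F_def)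
      then show ?thesis using 2 prob_not_size2[OF assms(1), of v] by (auto simp: tree_instance_def)
    qed auto
  qed auto
  also have "\<dots> = 1 / real H * (\<Prod>x\<in>verts ?I. if x \<in> Node ` (L - {u}) then ?q else 1)"
    using nodes[OF assms(2)] by (simp add: prod.distrib prod.delta finite_verts)
  also have "(\<Prod>x\<in>verts ?I. if x \<in> Node ` (L - {u}) then ?q else 1)
      = (\<Prod>x\<in>verts ?I \<inter> Node ` (L - {u}). ?q)"
    by (rule prod.inter_restrict[symmetric, OF finite_verts])
  also have "verts ?I \<inter> Node ` (L - {u}) = Node ` (L - {u})"
    using assms(3) nodes by auto
  also have "(\<Prod>x\<in>Node ` (L - {u}). ?q) = ?q ^ card (L - {u})"
    by (simp add: card_image inj_on_def)
  finally show ?thesis .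
qed

lemma expected_reward_nth:
  assumes "H \<ge> 4" "set xs \<subseteq> tree_nodes H" "distinct xs" "sorted_wrt strict_prefix xs" "i < length xs"
  shows "measure_pmf.expectation (outcomes (tree_instance H))
      (\<lambda>\<omega>. if (\<Sum>h\<le>i. fst (\<omega> (Node (xs ! h)))) \<le> tree_W H then snd (\<omega> (Node (xs ! i))) else 0)
    \<le> 1 / real H * (1 - 1 / sqrt (real H)) ^ i"
proof -
  let ?M = "outcomes (tree_instance H)" and ?q = "1 - 1 / sqrt (real H)"
  define u where "u = xs ! i"
  \<comment> \<open>The earlier visited vertices at which the path to \<open>u\<close> turns
    left.\<close>
  define L where "L = {v \<in> set (take i xs). prefix (v @ [False]) u}"
  define A :: "(vertex \<Rightarrow> real \<times> real) set" where
    "A = {\<omega>. snd (\<omega> (Node u)) \<noteq> 0 \<and> (\<forall>v\<in>L. v \<noteq> u \<longrightarrow> fst (\<omega> (Node v)) \<noteq> size2 H v)}"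
  have u: "u \<in> tree_nodes H" using assms by (auto simp: u_def)
  have L: "L \<subseteq> tree_nodes H" using assms(2) by (auto simp: L_def dest: in_set_takeD)
  have "u \<notin> L" by (auto simp: L_def)
  \<comment> \<open>On the support, a collected nonzero reward is \<open>reward1 H u\<close>, and it
    forces the outcome into \<open>A\<close>.\<close>
  have "measure_pmf.expectation ?M
      (\<lambda>\<omega>. if (\<Sum>h\<le>i. fst (\<omega> (Node (xs ! h)))) \<le> tree_W H then snd (\<omega> (Node (xs ! i))) else 0)
      \<le> measure_pmf.expectation ?M (\<lambda>\<omega>. reward1 H u * indicator A \<omega>)"
  proof (intro integral_mono_AE)
    show "AE \<omega> in ?M. (if (\<Sum>h\<le>i. fst (\<omega> (Node (xs ! h)))) \<le> tree_W H
        then snd (\<omega> (Node (xs ! i))) else 0) \<le> reward1 H u * indicator A \<omega>"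
    proof (intro AE_pmfI)
      fix \<omega> assume \<omega>: "\<omega> \<in> set_pmf ?M"
      show "(if (\<Sum>h\<le>i. fst (\<omega> (Node (xs ! h)))) \<le> tree_W H
        then snd (\<omega> (Node (xs ! i))) else 0) \<le> reward1 H u * indicator A \<omega>"
      proof (cases "(\<Sum>h\<le>i. fst (\<omega> (Node (xs ! h)))) \<le> tree_W H \<and> snd (\<omega> (Node u)) \<noteq> 0")
        case True
        then have "\<omega> \<in> A"
          using collected_imp_not_size2[OF assms(1) \<omega> assms(2,5)] by (auto simp: A_def L_def u_def)
        then show ?thesis
          using outcomes_cases[OF assms(1) \<omega> u] reward1_nonneg[OF assms(1), of u] by (auto simp: u_def)
      qed (use reward1_nonneg[OF assms(1), of u] in \<open>auto simp: u_def\<close>)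
    qed
  qed (auto intro!: integrable_measure_pmf_finite finite_set_outcomes assms(1))
  also have "\<dots> = reward1 H u * measure_pmf.prob ?M A"
    by simp
  also have "\<dots> \<le> reward1 H u * (1 / real H * ?q ^ card (L - {u}))"
    unfolding A_def using assms(1) u L
    by (intro mult_left_mono prob_reward_and_not_size2 reward1_nonneg)
  also have "\<dots> = 1 / real H * ?q ^ (card (rt u) + card L)"
    using \<open>u \<notin> L\<close> by (simp add: reward1_def power_add)
  \<comment> \<open>Each of the \<open>i\<close> earlier vertices is a strict prefix of
    \<open>u\<close>; the turn taken there puts it into \<open>rt u\<close> or \<open>L\<close>. As
    \<open>?q\<close> is at most 1, unvisited nodes in \<open>rt u\<close> only lower the
    value.\<close>
  also have "\<dots> \<le> 1 / real H * ?q ^ i"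
  proof -
    have "set (take i xs) \<subseteq> rt u \<union> L"
    proof
      fix w assume w: "w \<in> set (take i xs)"
      then have "strict_prefix w u"
        using assms(4,5) by (auto simp: in_set_conv_nth u_def sorted_wrt_iff_nth_less)
      then obtain b zs where "u = w @ b # zs"
        by (auto elim: strict_prefixE')
      then have "u = (w @ [b]) @ zs" by simp
      then show "w \<in> rt u \<union> L" using w
        by (cases b) (auto simp: rt_def root_path_def L_def)
    qed
    then have "card (set (take i xs)) \<le> card (rt u \<union> L)"
      by (intro card_mono) (auto simp: finite_rt L_def)
    also have "\<dots> \<le> card (rt u) + card L" by (rule card_Un_le)
    finally have "i \<le> card (rt u) + card L"
      using assms(3,5) by (simp add: distinct_card)
    then show ?thesis
      using one_minus_inverse_sqrt_bounds[OF assms(1)] by (intro mult_left_mono power_decreasing) auto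
  qed
  finally show ?thesis .
qed

lemma expected_reward_chain:
  assumes "H \<ge> 4" "set xs \<subseteq> tree_nodes H" "distinct xs" "sorted_wrt strict_prefix xs"
  shows "measure_pmf.expectation (outcomes (tree_instance H))
      (\<lambda>\<omega>. collected_reward (tree_instance H) \<omega> (map Node xs)) \<le> 1 / sqrt (real H)"
proof -
  let ?M = "outcomes (tree_instance H)" and ?q = "1 - 1 / sqrt (real H)" and ?n = "length xs"
  have "collected_reward (tree_instance H) \<omega> (map Node xs) = (\<Sum>i<?n.
      if (\<Sum>h\<le>i. fst (\<omega> (Node (xs ! h)))) \<le> tree_W H then snd (\<omega> (Node (xs ! i))) else 0)" for \<omega>
    unfolding collected_reward_def
    by (intro sum.cong) (auto simp: tree_instance_def intro!: arg_cong2[where f = "(\<le>)"] sum.cong)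
  then have "measure_pmf.expectation ?M (\<lambda>\<omega>. collected_reward (tree_instance H) \<omega> (map Node xs))
      = (\<Sum>i<?n. measure_pmf.expectation ?M
        (\<lambda>\<omega>. if (\<Sum>h\<le>i. fst (\<omega> (Node (xs ! h)))) \<le> tree_W H then snd (\<omega> (Node (xs ! i))) else 0))"
    by (simp add: Bochner_Integration.integral_sum integrable_measure_pmf_finite
        finite_set_outcomes[OF assms(1)])
  also have "\<dots> \<le> (\<Sum>i<?n. 1 / real H * ?q ^ i)"
    by (intro sum_mono expected_reward_nth) (use assms in auto)
  also have "\<dots> = 1 / real H * (\<Sum>i<?n. ?q ^ i)"
    by (simp add: sum_distrib_left)
  \<comment> \<open>Geometric sum, with 1 - \<open>?q\<close> = 1 / sqrt H.\<close>
  also have "(\<Sum>i<?n. ?q ^ i) = (1 - ?q ^ ?n) * sqrt (real H)"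
    using one_diff_power_eq[of ?q ?n] assms(1) by (simp add: field_simps)
  also have "1 / real H * \<dots> \<le> 1 / real H * (1 * sqrt (real H))"
    using one_minus_inverse_sqrt_bounds[OF assms(1)] by (intro mult_left_mono mult_right_mono) auto
  also have "\<dots> = 1 / sqrt (real H)"
    using sqrt_divide_self_eq[of "real H"] by (simp add: inverse_eq_divide)
  finally show ?thesis .
qed

section \<open>From the random stopping point to a fixed prefix\<close>

text \<open>Whether a reward is collected depends only on the jobs up to that visit, so further
  visits add nonnegative terms.\<close>

lemma collected_reward_take_mono:
  assumes "H \<ge> 4" "\<omega> \<in> set_pmf (outcomes (tree_instance H))"
    and "set xs \<subseteq> tree_nodes H" "m \<le> n"
  shows "collected_reward (tree_instance H) \<omega> (take m (map Node xs))
    \<le> collected_reward (tree_instance H) \<omega> (take n (map Node xs))"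
proof -
  have take: "collected_reward (tree_instance H) \<omega> (take k (map Node xs))
      = (\<Sum>i<min k (length xs). if (\<Sum>h\<le>i. fst (\<omega> (Node (xs ! h)))) \<le> tree_W H
          then snd (\<omega> (Node (xs ! i))) else 0)" for k
    unfolding collected_reward_def
    by (intro sum.cong) (auto simp: tree_instance_def intro!: arg_cong2[where f = "(\<le>)"] sum.cong)
  show ?thesis
    unfolding take using assms by (intro sum_mono2) (auto intro!: outcomes_nonneg)
qed

theorem theorem3p2:
  fixes H :: nat and vs :: "vertex list"
  assumes "H \<ge> 4"
    and "nonadaptive_policy (tree_instance H) vs"
  shows "expected_reward (tree_instance H) vs \<le> 2 / sqrt (real H)"
proof -
  let ?I = "tree_instance H"
  have sub: "set vs \<subseteq> insert Dummy (Node ` tree_nodes H)" and dist: "distinct (Dummy # vs)"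
    using assms(2) by (auto simp: nonadaptive_policy_def tree_instance_def)
  then have "set vs \<subseteq> Node ` tree_nodes H" by auto
  then have "vs \<in> lists (Node ` tree_nodes H)" by auto
  then obtain xs where vs: "vs = map Node xs" and xs: "set xs \<subseteq> tree_nodes H"
    by (auto simp: lists_image)
  have xs_dist: "distinct xs" using dist vs by (simp add: distinct_map)
  \<comment> \<open>The longest prefix allowed by the travel budget alone. It does not depend on the
    outcome \<open>\<omega>\<close>, whereas \<open>visited\<close> does through the processing
    budget.\<close>
  define N where "N = (GREATEST n. n \<le> length vs \<and> travel_length ?I (take n vs) \<le> tree_B H)"
  \<comment> \<open>The set is bounded by \<open>length vs\<close> and contains 0, so the maximum is
    attained.\<close>
  have greatest: "(GREATEST n. n \<le> length vs \<and> P n) \<le> length vs \<and> P (GREATEST n. n \<le> length vs \<and> P n)"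
    if "P 0" for P
    using GreatestI_nat[of "\<lambda>n. n \<le> length vs \<and> P n" 0 "length vs"] that by simp
  have start_ok: "travel_length ?I (take 0 vs) \<le> tree_B H"
    by (simp add: travel_length_def tree_B_def)
  have N: "N \<le> length vs \<and> travel_length ?I (take N vs) \<le> tree_B H"
    unfolding N_def by (rule greatest[of "\<lambda>n. travel_length ?I (take n vs) \<le> tree_B H", OF start_ok])
  have set_N: "set (take N xs) \<subseteq> tree_nodes H" using xs by (auto dest: in_set_takeD)
  have "collected_reward ?I \<omega> (visited ?I \<omega> vs) \<le> collected_reward ?I \<omega> (take N vs)"
    if "\<omega> \<in> set_pmf (outcomes ?I)" for \<omega>
  proof -
    define n where "n = (GREATEST n. n \<le> length vs \<and> within_budgets ?I \<omega> (take n vs))"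
    have "within_budgets ?I \<omega> (take 0 vs)"
      using start_ok by (simp add: within_budgets_def tree_instance_def tree_W_def)
    then have "n \<le> length vs \<and> within_budgets ?I \<omega> (take n vs)"
      unfolding n_def by (rule greatest[of "\<lambda>n. within_budgets ?I \<omega> (take n vs)"])
    then have "n \<le> length vs \<and> travel_length ?I (take n vs) \<le> tree_B H"
      by (simp add: within_budgets_def tree_instance_def)
    then have "n \<le> N"
      unfolding N_def by (rule Greatest_le_nat[where b = "length vs"]) auto
    then show ?thesis
      unfolding visited_def n_def[symmetric]
      using collected_reward_take_mono[OF assms(1) that xs] by (simp add: vs)
  qed
  then have "expected_reward ?I vs
      \<le> measure_pmf.expectation (outcomes ?I) (\<lambda>\<omega>. collected_reward ?I \<omega> (map Node (take N xs)))"
    unfolding expected_reward_def vs take_map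
    by (intro integral_mono_AE integrable_measure_pmf_finite finite_set_outcomes assms(1) AE_pmfI)
  also have "\<dots> \<le> 1 / sqrt (real H)"
    using N set_N xs_dist unfolding vs take_map
    by (intro expected_reward_chain strict_prefix_within_travel_budget assms(1)) auto
  also have "\<dots> \<le> 2 / sqrt (real H)"
    by (simp add: divide_right_mono)
  finally show ?thesis .
qed

end
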